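(* Let $n>0$ be an integer. (1) The following universal linearization properties hold. (a) Let $C_1,\dots,C_n\in\mathcal{AC}$ and let $u:\prod_{i} C_i\to \bigotimes_i C_i$ be the map $u(v_1,\dots,v_n)=v_1\otimes\cdots\otimes v_n$. For every $D\in\mathcal{AC}$ and every multilinear map $T:\prod_i C_i\to D$ there is a unique $t\in\mathrm{Hom}_{\mathcal{AC}}(\bigotimes_i C_i,D)$ such that $T=t\circ u$. (b) Let $C_1\in\mathcal{AC}$ and let $q:C_1^n\to\mathrm{Sym}^n(C_1)$ be the map $q(v_1,\dots,v_n)=v_1\cdots v_n$. For every $D\in\mathcal{AC}$ and every multilinear symmetric map $T:C_1^n\to D$ there is a unique $t\in\mathrm{Hom}_{\mathcal{AC}}(\mathrm{Sym}^n(C_1),D)$ such that $T=t\circ q$. (2) For every $A,B,C\in\mathcal{AC}$ there is an adjunction isomorphism $$\mathrm{Hom}_{\mathcal{AC}}(A\otimes B,C)\cong\mathrm{Hom}_{\mathcal{AC}}(A,\mathrm{Hom}_{\mathcal{AC}}(B,C)).$$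
   Context: All vector spaces are real and finite-dimensional. A cone in $V$ is a subset closed under nonnegative linear combinations; it is pointed if some $\phi\in V^*$ satisfies $\phi\ge0$ on $C$ and $C\cap\ker\phi=\{0\}$. Category $\mathcal{AC}$: objects are pairs $(C,V)$ with $C\subseteq V$ a pointed, closed, full-dimensional convex cone, denoted $C$, with $LC:=V$; morphisms $\mathrm{Hom}_{\mathcal{AC}}(C_1,C_2)$ are the linear maps $f:LC_1\to LC_2$ with $f(C_1)\subseteq C_2$. The set $\mathrm{Hom}_{\mathcal{AC}}(C_1,C_2)$ is regarded as a cone in $\mathrm{Hom}(LC_1,LC_2)$ (it is an object of $\mathcal{AC}$). Tensor products: $\bigotimes_i C_i:=\mathrm{Cone}\{c_1\otimes\cdots\otimes c_n:c_i\in C_i\}\subseteq\bigotimes_i LC_i$. Symmetric powers: $\mathrm{Sym}^n(C):=\mathrm{Cone}\{v_1\cdots v_n:v_i\in C\}\subseteq\mathrm{Sym}^n(LC)$. These are objects of $\mathcal{AC}$. A function $T:\prod C_i\to D$ is multilinear if it is the restriction of a multilinear function $T:\prod LC_i\to LD$ satisfying $T(\prod C_i)\subseteq D$. A multilinear $T:C_1^n\to D$ is symmetric if $T(v_{\sigma(1)},\dots,v_{\sigma(n)})=T(v_1,\dots,v_n)$ for all permutations $\sigma\in S_n$ and all $v_i\in C_1$. *)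

theory Defs
  imports
    "HOL-Analysis.Analysis"
    "HOL-Analysis.Finite_Function_Topology"
    "HOL-Library.Function_Algebras"
    "HOL-Combinatorics.Permutations"
begin

section \<open>Linear maps between subspaces\<close>

text \<open>Functions into a real vector space form a real vector space under the pointwise operations.\<close>

instantiation "fun" :: (type, real_vector) real_vector
begin

definition scaleR_fun :: "real \<Rightarrow> ('a \<Rightarrow> 'b) \<Rightarrow> 'a \<Rightarrow> 'b"
  where "scaleR_fun r f = (\<lambda>x. r *\<^sub>R f x)"

instance
  by standard (simp_all add: scaleR_fun_def fun_eq_iff scaleR_add_right scaleR_add_left)

end

text \<open>
  A vector space is represented by a subspace \<open>V\<close> of some type of class \<open>real_vector\<close>, so that
  families of different spaces \<open>V\<^sub>1, \<dots>, V\<^sub>n\<close> with variable \<open>n\<close> can be expressed.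
  A linear map \<open>V \<rightarrow> W\<close> is represented by the function that is extended by zero outside \<open>V\<close>.
  This makes the representation unique, makes \<open>Hom(V, W)\<close> a subspace of the function type, and makes
  composition of morphisms the composition of functions.
\<close>

definition linear_maps :: "'a::real_vector set \<Rightarrow> 'b::real_vector set \<Rightarrow> ('a \<Rightarrow> 'b) set"
  where "linear_maps V W =
    {f. (\<forall>x\<in>V. f x \<in> W) \<and>
        (\<forall>x\<in>V. \<forall>y\<in>V. f (x + y) = f x + f y) \<and>
        (\<forall>r. \<forall>x\<in>V. f (r *\<^sub>R x) = r *\<^sub>R f x) \<and>
        (\<forall>x. x \<notin> V \<longrightarrow> f x = 0)}"

definition dual :: "'a::real_vector set \<Rightarrow> ('a \<Rightarrow> real) set"
  where "dual V = linear_maps V UNIV"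


section \<open>The category of pointed, closed, full-dimensional cones\<close>

text \<open>
  The initial topology on \<open>V\<close> with respect to all linear functionals.  For finite-dimensional \<open>V\<close>
  it is the usual (Euclidean) topology; the lemma below confirms this for \<open>V = UNIV\<close>.
\<close>

definition canonical_topology :: "'a::real_vector set \<Rightarrow> 'a topology"
  where "canonical_topology V =
    pullback_topology V (\<lambda>v. \<lambda>\<phi>\<in>dual V. \<phi> v) (product_topology (\<lambda>_. euclideanreal) (dual V))"

lemma closedin_canonical_topology_UNIV:
  fixes S :: "'a::euclidean_space set"
  shows "closedin (canonical_topology UNIV) S \<longleftrightarrow> closed S"
proof -
  define D where "D = dual (UNIV :: 'a set)"
  define P where "P = product_topology (\<lambda>_. euclideanreal) D"
  define f where "f = (\<lambda>v::'a. \<lambda>\<phi>\<in>D. \<phi> v)"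
  define g where "g = (\<lambda>r::('a \<Rightarrow> real) \<Rightarrow> real. \<Sum>b\<in>Basis. r (\<lambda>v. v \<bullet> b) *\<^sub>R b)"
  have lin: "linear \<phi>" if "\<phi> \<in> D" for \<phi>
    using that by (auto simp: D_def dual_def linear_maps_def intro: linearI)
  have inner: "(\<lambda>v. v \<bullet> b) \<in> D" for b :: 'a
    by (auto simp: D_def dual_def linear_maps_def inner_add_left)
  have f: "continuous_map euclidean P f"
    unfolding P_def f_def continuous_map_componentwise
    by (auto intro!: linear_continuous_on simp: lin simp flip: linear_conv_bounded_linear)
  have "continuous_map P euclidean (\<lambda>r. r (\<lambda>v. v \<bullet> b) *\<^sub>R b)" for b :: 'a
  proof -
    have "continuous_map P euclideanreal (\<lambda>r. r (\<lambda>v. v \<bullet> b))"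
      unfolding P_def by (intro continuous_map_product_projection inner)
    moreover have "continuous_map euclideanreal euclidean (\<lambda>t. t *\<^sub>R b)"
      by (auto intro!: continuous_intros)
    ultimately show ?thesis
      using continuous_map_compose[of P euclideanreal _ euclidean "\<lambda>t. t *\<^sub>R b"]
      by (simp add: o_def)
  qed
  then have g: "continuous_map P euclidean g"
    unfolding g_def by (intro continuous_map_sum) auto
  have gf: "g (f v) = v" for v
    by (simp add: g_def f_def inner euclidean_representation)
  have top: "canonical_topology UNIV = pullback_topology UNIV f P"
    unfolding canonical_topology_def f_def P_def D_def ..
  have open_iff: "openin (canonical_topology UNIV) U \<longleftrightarrow> open U" for U :: "'a set"
  proof
    assume "openin (canonical_topology UNIV) U"
    then obtain W where "openin P W" "U = f -` W"
      by (auto simp: top openin_pullback_topology)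
    then show "open U"
      using openin_continuous_map_preimage[OF f, of W] by (simp add: vimage_def)
  next
    assume "open U"
    then have "openin P {r \<in> topspace P. g r \<in> U}"
      using openin_continuous_map_preimage[OF g, of U] by simp
    moreover have "U = f -` {r \<in> topspace P. g r \<in> U} \<inter> UNIV"
      using gf by (auto simp: P_def f_def)
    ultimately show "openin (canonical_topology UNIV) U"
      unfolding top openin_pullback_topology by blast
  qed
  have "topspace (canonical_topology UNIV) = (UNIV :: 'a set)"
    using open_iff openin_topspace open_UNIV openin_subset by blast
  with open_iff show ?thesis
    by (simp add: closedin_def closed_def Compl_eq_Diff_UNIV)
qed

definition pointed :: "'a::real_vector set \<Rightarrow> 'a set \<Rightarrow> bool"
  where "pointed C V \<longleftrightarrow> (\<exists>\<phi>\<in>dual V. (\<forall>c\<in>C. 0 \<le> \<phi> c) \<and> C \<inter> {v\<in>V. \<phi> v = 0} = {0})"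

text \<open>A pair \<open>(C, V)\<close>: the cone \<open>C\<close> and its ambient space \<open>LC = V\<close>.\<close>

type_synonym 'a conic_space = "'a set \<times> 'a set"

abbreviation cone_of :: "'a conic_space \<Rightarrow> 'a set"
  where "cone_of \<equiv> fst"

abbreviation L :: "'a conic_space \<Rightarrow> 'a set"
  where "L \<equiv> snd"

definition AC :: "'a::real_vector conic_space set"
  where "AC = {(C, V).
    subspace V \<and> (\<exists>B. finite B \<and> V = span B) \<and>
    C \<subseteq> V \<and> convex_cone C \<and> pointed C V \<and> closedin (canonical_topology V) C \<and> span C = V}"

definition Hom_AC :: "'a::real_vector conic_space \<Rightarrow> 'b::real_vector conic_space \<Rightarrow> ('a \<Rightarrow> 'b) set"
  where "Hom_AC X Y = {f \<in> linear_maps (L X) (L Y). f ` cone_of X \<subseteq> cone_of Y}"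

text \<open>\<open>Hom_AC X Y\<close> as a cone in \<open>Hom(LX, LY)\<close>.\<close>

definition Hom_cone ::
  "'a::real_vector conic_space \<Rightarrow> 'b::real_vector conic_space \<Rightarrow> ('a \<Rightarrow> 'b) conic_space"
  where "Hom_cone X Y = (Hom_AC X Y, linear_maps (L X) (L Y))"

definition iso_AC ::
  "'a::real_vector conic_space \<Rightarrow> 'b::real_vector conic_space \<Rightarrow> ('a \<Rightarrow> 'b) \<Rightarrow> bool"
  where "iso_AC X Y f \<longleftrightarrow> f \<in> Hom_AC X Y \<and>
    (\<exists>g\<in>Hom_AC Y X. (\<forall>x\<in>L X. g (f x) = x) \<and> (\<forall>y\<in>L Y. f (g y) = y))"


section \<open>Tensor products and symmetric powers\<close>

text \<open>
  The free real vector space on all tuples of elements of \<open>'a\<close> (lists, of any length) modulo the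
  multilinearity relations, that is, the direct sum of all tensor powers of \<open>'a\<close>.  For subspaces
  \<open>V\<^sub>1, \<dots>, V\<^sub>n\<close> of \<open>'a\<close> the tensor product \<open>V\<^sub>1 \<otimes> \<dots> \<otimes> V\<^sub>n\<close> embeds as the span of the
  \<open>v\<^sub>1 \<otimes> \<dots> \<otimes> v\<^sub>n\<close> with \<open>v\<^sub>i\<close> in \<open>V\<^sub>i\<close>, since subspaces have complements.
\<close>

definition multilinearity_relations :: "('a::real_vector list \<Rightarrow>\<^sub>0 real) set"
  where "multilinearity_relations =
    {Poly_Mapping.single (xs @ (x + y) # ys) 1
       - Poly_Mapping.single (xs @ x # ys) 1 - Poly_Mapping.single (xs @ y # ys) 1 | xs x y ys. True} \<union>
    {Poly_Mapping.single (xs @ (r *\<^sub>R x) # ys) 1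
       - r *\<^sub>R Poly_Mapping.single (xs @ x # ys) 1 | xs r x ys. True}"

lemma equivp_diff_in_span: "equivp (\<lambda>p q. p - q \<in> span S)"
proof (rule equivpI)
  show "reflp (\<lambda>p q. p - q \<in> span S)"
    by (rule reflpI) (simp add: span_zero)
  show "symp (\<lambda>p q. p - q \<in> span S)"
    by (rule sympI) (metis minus_diff_eq span_neg)
  show "transp (\<lambda>p q. p - q \<in> span S)"
    by (rule transpI) (metis diff_add_cancel add_diff_eq span_add)
qed

quotient_type (overloaded) 'a tensor = "'a::real_vector list \<Rightarrow>\<^sub>0 real" /
  "\<lambda>p q. p - q \<in> span multilinearity_relations"
  by (rule equivp_diff_in_span)

lemma diff_in_span_add:
  "a - b \<in> span S \<Longrightarrow> c - d \<in> span S \<Longrightarrow> (a + c) - (b + d) \<in> span S"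
  by (metis add_diff_add span_add)

lemma diff_in_span_diff:
  "a - b \<in> span S \<Longrightarrow> c - d \<in> span S \<Longrightarrow> (a - c) - (b - d) \<in> span S"
  using span_diff[of "a - b" S "c - d"] by (simp add: algebra_simps)

lemma diff_in_span_uminus: "a - b \<in> span S \<Longrightarrow> - a - - b \<in> span S"
  using span_neg[of "a - b" S] by (simp add: algebra_simps)

lemma diff_in_span_scaleR: "a - b \<in> span S \<Longrightarrow> r *\<^sub>R a - r *\<^sub>R b \<in> span S"
  by (metis scaleR_right_diff_distrib span_scale)

instantiation tensor :: (real_vector) real_vector
begin

lift_definition zero_tensor :: "'a tensor" is 0 .

lift_definition plus_tensor :: "'a tensor \<Rightarrow> 'a tensor \<Rightarrow> 'a tensor" is "(+)"
  by (rule diff_in_span_add)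

lift_definition minus_tensor :: "'a tensor \<Rightarrow> 'a tensor \<Rightarrow> 'a tensor" is "(-)"
  by (rule diff_in_span_diff)

lift_definition uminus_tensor :: "'a tensor \<Rightarrow> 'a tensor" is uminus
  by (rule diff_in_span_uminus)

lift_definition scaleR_tensor :: "real \<Rightarrow> 'a tensor \<Rightarrow> 'a tensor" is "scaleR"
  by (rule diff_in_span_scaleR)

instance
  by standard (transfer; simp add: algebra_simps span_zero)+

end

text \<open>\<open>tensor_of [v\<^sub>1, \<dots>, v\<^sub>n]\<close> is \<open>v\<^sub>1 \<otimes> \<dots> \<otimes> v\<^sub>n\<close>.\<close>

lift_definition tensor_of :: "'a::real_vector list \<Rightarrow> 'a tensor"
  is "\<lambda>xs. Poly_Mapping.single xs 1" .

text \<open>Cartesian products of a list of sets are given by \<open>listset\<close>.\<close>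

definition Tensor :: "'a::real_vector conic_space list \<Rightarrow> 'a tensor conic_space"
  where "Tensor Cs =
    (convex_cone hull (tensor_of ` listset (map cone_of Cs)), span (tensor_of ` listset (map L Cs)))"

text \<open>The direct sum of all symmetric powers of \<open>'a\<close>, as the coinvariants of the tensor powers.\<close>

definition permutation_relations :: "'a::real_vector tensor set"
  where "permutation_relations =
    {tensor_of xs - tensor_of (permute_list \<sigma> xs) | xs \<sigma>. \<sigma> permutes {..<length xs}}"

quotient_type (overloaded) 'a sym_tensor = "'a::real_vector tensor" /
  "\<lambda>s t. s - t \<in> span permutation_relations"
  by (rule equivp_diff_in_span)

instantiation sym_tensor :: (real_vector) real_vector
begin

lift_definition zero_sym_tensor :: "'a sym_tensor" is 0 .

lift_definition plus_sym_tensor :: "'a sym_tensor \<Rightarrow> 'a sym_tensor \<Rightarrow> 'a sym_tensor" is "(+)"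
  by (rule diff_in_span_add)

lift_definition minus_sym_tensor :: "'a sym_tensor \<Rightarrow> 'a sym_tensor \<Rightarrow> 'a sym_tensor" is "(-)"
  by (rule diff_in_span_diff)

lift_definition uminus_sym_tensor :: "'a sym_tensor \<Rightarrow> 'a sym_tensor" is uminus
  by (rule diff_in_span_uminus)

lift_definition scaleR_sym_tensor :: "real \<Rightarrow> 'a sym_tensor \<Rightarrow> 'a sym_tensor" is "scaleR"
  by (rule diff_in_span_scaleR)

instance
  by standard (transfer; simp add: algebra_simps span_zero)+

end

text \<open>\<open>sym_of [v\<^sub>1, \<dots>, v\<^sub>n]\<close> is the symmetric product \<open>v\<^sub>1 \<cdots> v\<^sub>n\<close>.\<close>

lift_definition sym_of :: "'a::real_vector list \<Rightarrow> 'a sym_tensor" is tensor_of .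

definition Sym :: "nat \<Rightarrow> 'a::real_vector conic_space \<Rightarrow> 'a sym_tensor conic_space"
  where "Sym n X =
    (convex_cone hull (sym_of ` listset (replicate n (cone_of X))),
     span (sym_of ` listset (replicate n (L X))))"


section \<open>Multilinear maps\<close>

definition multilinear_on :: "'a::real_vector set list \<Rightarrow> 'b::real_vector set \<Rightarrow> ('a list \<Rightarrow> 'b) \<Rightarrow> bool"
  where "multilinear_on Vs W T \<longleftrightarrow>
    (\<forall>xs\<in>listset Vs. T xs \<in> W) \<and>
    (\<forall>xs x y ys. xs @ x # ys \<in> listset Vs \<and> xs @ y # ys \<in> listset Vs \<longrightarrow>
       T (xs @ (x + y) # ys) = T (xs @ x # ys) + T (xs @ y # ys)) \<and>
    (\<forall>xs r x ys. xs @ x # ys \<in> listset Vs \<longrightarrow>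
       T (xs @ (r *\<^sub>R x) # ys) = r *\<^sub>R T (xs @ x # ys))"

text \<open>The values of \<open>T\<close> outside the product of the cones are irrelevant.\<close>

definition multilinear_AC ::
  "'a::real_vector conic_space list \<Rightarrow> 'b::real_vector conic_space \<Rightarrow> ('a list \<Rightarrow> 'b) \<Rightarrow> bool"
  where "multilinear_AC Cs D T \<longleftrightarrow>
    (\<exists>T'. multilinear_on (map L Cs) (L D) T' \<and>
          T' ` listset (map cone_of Cs) \<subseteq> cone_of D \<and>
          (\<forall>xs\<in>listset (map cone_of Cs). T xs = T' xs))"

definition symmetric_AC :: "nat \<Rightarrow> 'a conic_space \<Rightarrow> ('a list \<Rightarrow> 'b) \<Rightarrow> bool"
  where "symmetric_AC n X T \<longleftrightarrow>
    (\<forall>\<sigma>. \<sigma> permutes {..<n} \<longrightarrow>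
      (\<forall>xs\<in>listset (replicate n (cone_of X)). T (permute_list \<sigma> xs) = T xs))"


section \<open>The tensor-hom adjunction\<close>

text \<open>The morphism \<open>\<alpha> \<otimes> \<beta> : A' \<otimes> B' \<rightarrow> A \<otimes> B\<close>.\<close>

definition tensor_map ::
  "'a::real_vector conic_space \<Rightarrow> 'a conic_space \<Rightarrow> 'b::real_vector conic_space \<Rightarrow> 'b conic_space
   \<Rightarrow> ('a \<Rightarrow> 'b) \<Rightarrow> ('a \<Rightarrow> 'b) \<Rightarrow> 'a tensor \<Rightarrow> 'b tensor"
  where "tensor_map A' B' A B \<alpha> \<beta> =
    (THE t. t \<in> linear_maps (L (Tensor [A', B'])) (L (Tensor [A, B])) \<and>
            (\<forall>a\<in>L A'. \<forall>b\<in>L B'. t (tensor_of [a, b]) = tensor_of [\<alpha> a, \<beta> b]))"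

text \<open>
  The currying map \<open>f \<mapsto> (a \<mapsto> (b \<mapsto> f (a \<otimes> b)))\<close>, extended by zero at each stage in accordance
  with the representation of linear maps.
\<close>

definition curry_AC ::
  "'a::real_vector conic_space \<Rightarrow> 'a conic_space \<Rightarrow> 'c::real_vector conic_space
   \<Rightarrow> ('a tensor \<Rightarrow> 'c) \<Rightarrow> 'a \<Rightarrow> 'a \<Rightarrow> 'c"
  where "curry_AC A B C f a b =
    (if f \<in> L (Hom_cone (Tensor [A, B]) C) \<and> a \<in> L A \<and> b \<in> L B then f (tensor_of [a, b]) else 0)"

end

theory Submission
  imports Defs
begin

text \<open>
  Everything rests on the universal property of the tensor product of vector spaces; the cones enter
  only at the end.

  A function \<open>T\<close> on all lists that is multilinear in every position extends linearly to the free
  vector space on lists.  The extension kills the multilinearity relations and therefore descends to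
  \<open>'a tensor\<close> (\<open>tensor_linearization\<close>); if \<open>T\<close> is also invariant under permutations, it descends
  further to \<open>'a sym_tensor\<close> (\<open>sym_linearization\<close>).  A multilinear map on a product of subspaces
  \<open>V\<^sub>1 \<times> \<dots> \<times> V\<^sub>n\<close> is brought into this form by composing it with linear projections onto the \<open>V\<^sub>i\<close>
  and setting it to zero on lists of other lengths (\<open>multilinear_extension\<close>).

  Two observations transfer this to cones (\<open>cone_linearization\<close>).  Since a cone \<open>C\<close> in the category
  spans \<open>LC\<close>, the products of elements of the cones already span the whole tensor or symmetric
  power (\<open>span_multilinear_image\<close>), which gives uniqueness.  And a linear map that sends these products
  into a convex cone \<open>D\<close> sends the convex cone generated by them into \<open>D\<close>, so that the
  linearization is a morphism as soon as the multilinear map respects the cones.  In the symmetric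
  case symmetry is assumed only on the cones; it carries over to the ambient space because a
  multilinear map is determined by its values on spanning sets (\<open>multilinear_on_eqI\<close>).

  For the adjunction, the universal property for two factors says that currying is a linear
  bijection from \<open>Hom(LA \<otimes> LB, LC)\<close> to \<open>Hom(LA, Hom(LB, LC))\<close>.  Since \<open>A \<otimes> B\<close> is generated by
  the \<open>a \<otimes> b\<close>, currying preserves and reflects membership in the cones
  (\<open>curry_in_cone_iff\<close>), so its inverse is a morphism too.
\<close>

section \<open>Multilinear functions on lists\<close>

text \<open>
  Lists of all lengths are treated at once, without carriers: such functions are exactly the linear
  maps out of the direct sum of all tensor powers of \<open>'a\<close>.
\<close>

definition multilinear :: "('a::real_vector list \<Rightarrow> 'b::real_vector) \<Rightarrow> bool"
  where "multilinear T \<longleftrightarrow>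
    (\<forall>xs x y ys. T (xs @ (x + y) # ys) = T (xs @ x # ys) + T (xs @ y # ys)) \<and>
    (\<forall>xs r x ys. T (xs @ (r *\<^sub>R x) # ys) = r *\<^sub>R T (xs @ x # ys))"

lemma in_listset_iff: "xs \<in> listset As \<longleftrightarrow> list_all2 (\<in>) xs As"
  by (induction As arbitrary: xs) (auto simp: set_Cons_def list_all2_Cons2)

lemma listset_mono: "list_all2 (\<subseteq>) As Bs \<Longrightarrow> listset As \<subseteq> listset Bs"
  by (induction rule: list_all2_induct) (auto simp: set_Cons_def)

lemma listset_subset_span: "listset Ss \<subseteq> listset (map span Ss)"
  by (rule listset_mono) (auto simp: list_all2_conv_all_nth span_base)

lemma length_in_listset: "xs \<in> listset As \<Longrightarrow> length xs = length As"
  by (simp add: in_listset_iff list_all2_lengthD)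

lemma in_listset_replicate: "xs \<in> listset (replicate n A) \<longleftrightarrow> length xs = n \<and> set xs \<subseteq> A"
  by (auto simp: in_listset_iff list_all2_conv_all_nth subset_iff in_set_conv_nth)

lemma tensor_of_eq_abs: "tensor_of xs = abs_tensor (Poly_Mapping.single xs 1)"
  by (simp add: tensor_of_def)

lemma sym_of_eq_abs: "sym_of xs = abs_sym_tensor (tensor_of xs)"
  by (simp add: sym_of_def)

lemma multilinear_tensor_of: "multilinear tensor_of"
proof -
  have "Poly_Mapping.single (xs @ (x + y) # ys) 1
      - (Poly_Mapping.single (xs @ x # ys) 1 + Poly_Mapping.single (xs @ y # ys) 1)
      \<in> span multilinearity_relations" for xs ys and x y :: 'a
    by (rule span_base) (auto simp: multilinearity_relations_def diff_diff_eq)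
  moreover have "Poly_Mapping.single (xs @ (r *\<^sub>R x) # ys) 1
      - r *\<^sub>R Poly_Mapping.single (xs @ x # ys) 1 \<in> span multilinearity_relations"
    for xs ys r and x :: 'a
    unfolding multilinearity_relations_def by (rule span_base) blast
  ultimately show ?thesis
    by (simp add: multilinear_def tensor_of_eq_abs plus_tensor.abs_eq scaleR_tensor.abs_eq
        tensor.abs_eq_iff)
qed

lemma multilinear_sym_of: "multilinear (sym_of :: 'a::real_vector list \<Rightarrow> _)"
  using multilinear_tensor_of[where ?'a = 'a]
  unfolding multilinear_def sym_of_eq_abs
  by (simp only: plus_sym_tensor.abs_eq scaleR_sym_tensor.abs_eq simp_thms)

text \<open>
  Expanding each argument \<open>x\<^sub>i \<in> span S\<^sub>i\<close> as a linear combination of elements of \<open>S\<^sub>i\<close>, one position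
  at a time, turns \<open>e xs\<close> into a linear combination of values of \<open>e\<close> on the product of the \<open>S\<^sub>i\<close>.
\<close>

lemma span_multilinear_image:
  assumes e: "multilinear e" and xs: "xs \<in> listset (map span Ss)"
  shows "e xs \<in> span (e ` listset Ss)"
proof -
  \<comment> \<open>The prefix \<open>us\<close> holds the arguments that have already been expanded.\<close>
  have "e (us @ xs) \<in> span ((\<lambda>ys. e (us @ ys)) ` listset Ss)" for us
    using xs
  proof (induction Ss arbitrary: us xs)
    case Nil
    then show ?case by (simp add: span_base)
  next
    case (Cons S Ss)
    obtain x ys where xs: "xs = x # ys" and x: "x \<in> span S" and ys: "ys \<in> listset (map span Ss)"
      using Cons.prems by (auto simp: set_Cons_def)
    let ?U = "span ((\<lambda>ys. e (us @ ys)) ` listset (S # Ss))"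
    have "e (us @ 0 # ys) = 0 *\<^sub>R e (us @ 0 # ys)"
      using e unfolding multilinear_def by (metis scale_zero_right)
    then have "subspace {z. e (us @ z # ys) \<in> ?U}"
      using e by (auto simp: subspace_def multilinear_def span_zero intro: span_add span_scale)
    moreover have "e (us @ s # ys) \<in> ?U" if "s \<in> S" for s
    proof -
      have "e ((us @ [s]) @ ys) \<in> span ((\<lambda>ys. e ((us @ [s]) @ ys)) ` listset Ss)"
        by (rule Cons.IH[OF ys])
      also have "\<dots> \<subseteq> ?U"
        using that by (intro span_mono) (auto simp: set_Cons_def)
      finally show ?thesis by simp
    qed
    ultimately show ?case
      using span_induct[OF x, of "\<lambda>z. e (us @ z # ys) \<in> ?U"] by (simp add: xs)
  qed
  from this[of "[]"] show ?thesis by simp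
qed

lemma span_multilinear_image_eq:
  assumes "multilinear e"
  shows "span (e ` listset (map span Ss)) = span (e ` listset Ss)"
proof
  show "span (e ` listset (map span Ss)) \<subseteq> span (e ` listset Ss)"
    using span_multilinear_image[OF assms] by (intro span_minimal) auto
  show "span (e ` listset Ss) \<subseteq> span (e ` listset (map span Ss))"
    by (intro span_mono image_mono listset_subset_span)
qed

section \<open>Universal properties of the quotients\<close>

lemma tensor_linearization:
  assumes T: "multilinear T"
  shows "\<exists>t. linear t \<and> (\<forall>xs. t (tensor_of xs) = T xs)"
proof -
  \<comment> \<open>the linear extension of \<open>T\<close> to the free vector space on lists\<close>
  define \<phi> where "\<phi> p = (\<Sum>k\<in>Poly_Mapping.keys p. Poly_Mapping.lookup p k *\<^sub>R T k)" for p
  have \<phi>_superset: "\<phi> p = (\<Sum>k\<in>A. Poly_Mapping.lookup p k *\<^sub>R T k)"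
    if "finite A" "Poly_Mapping.keys p \<subseteq> A" for p A
    unfolding \<phi>_def using that by (intro sum.mono_neutral_left) (auto simp: in_keys_iff)
  have lookup_scaleR: "Poly_Mapping.lookup (r *\<^sub>R p) k = r * Poly_Mapping.lookup p k"
    for r k and p :: "'a list \<Rightarrow>\<^sub>0 real"
  proof -
    have "finite {k. r * Poly_Mapping.lookup p k \<noteq> 0}"
      by (rule finite_subset[OF _ finite_lookup[of p]]) auto
    then show ?thesis by (simp add: scaleR_poly_mapping_def)
  qed
  have lin: "linear \<phi>"
  proof (rule linearI)
    fix p q :: "'a list \<Rightarrow>\<^sub>0 real" and r :: real
    let ?A = "Poly_Mapping.keys p \<union> Poly_Mapping.keys q"
    show "\<phi> (p + q) = \<phi> p + \<phi> q"
      using \<phi>_superset[of ?A p] \<phi>_superset[of ?A q] \<phi>_superset[of ?A "p + q"] keys_add[of p q]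
      by (simp add: lookup_add scaleR_add_left sum.distrib)
    have "Poly_Mapping.keys (r *\<^sub>R p) \<subseteq> Poly_Mapping.keys p"
      by (auto simp: in_keys_iff lookup_scaleR)
    then show "\<phi> (r *\<^sub>R p) = r *\<^sub>R \<phi> p"
      using \<phi>_superset[of "Poly_Mapping.keys p" "r *\<^sub>R p"] \<phi>_superset[of "Poly_Mapping.keys p" p]
      by (simp add: lookup_scaleR scaleR_sum_right)
  qed
  have single: "\<phi> (Poly_Mapping.single xs 1) = T xs" for xs
    by (simp add: \<phi>_def)
  have "\<phi> p = 0" if "p \<in> span multilinearity_relations" for p
    using that
  proof (rule linear_eq_0_on_span[OF lin, rotated])
    fix q :: "'a list \<Rightarrow>\<^sub>0 real" assume "q \<in> multilinearity_relations"
    then show "\<phi> q = 0"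
      using T unfolding multilinearity_relations_def multilinear_def
      by (auto simp: linear_diff[OF lin] linear_scale[OF lin] single)
  qed
  then have \<phi>_cong: "\<phi> p = \<phi> q" if "p - q \<in> span multilinearity_relations" for p q
    using that linear_diff[OF lin, of p q] by simp
  define t where "t z = \<phi> (rep_tensor z)" for z
  have t_abs: "t (abs_tensor p) = \<phi> p" for p
    unfolding t_def
    by (rule \<phi>_cong) (simp flip: tensor.abs_eq_iff add: Quotient3_abs_rep[OF Quotient3_tensor])
  have "linear t"
  proof (rule linearI)
    fix x y :: "'a tensor" and r :: real
    obtain p q where "x = abs_tensor p" "y = abs_tensor q"
      by (metis Quotient3_abs_rep[OF Quotient3_tensor])
    then show "t (x + y) = t x + t y" "t (r *\<^sub>R x) = r *\<^sub>R t x"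
      by (simp_all add: plus_tensor.abs_eq scaleR_tensor.abs_eq t_abs linear_add[OF lin]
          linear_scale[OF lin])
  qed
  then show ?thesis
    by (auto simp: tensor_of_eq_abs t_abs single)
qed

lemma sym_linearization:
  assumes T: "multilinear T"
    and sym: "\<And>\<sigma> xs. \<sigma> permutes {..<length xs} \<Longrightarrow> T (permute_list \<sigma> xs) = T xs"
  shows "\<exists>t. linear t \<and> (\<forall>xs. t (sym_of xs) = T xs)"
proof -
  obtain s where lin: "linear s" and s: "\<And>xs. s (tensor_of xs) = T xs"
    using tensor_linearization[OF T] by blast
  have "s p = 0" if "p \<in> span permutation_relations" for p
    using that
    by (rule linear_eq_0_on_span[OF lin, rotated])
      (auto simp: permutation_relations_def linear_diff[OF lin] s sym)
  then have s_cong: "s p = s q" if "p - q \<in> span permutation_relations" for p q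
    using that linear_diff[OF lin, of p q] by simp
  define t where "t z = s (rep_sym_tensor z)" for z
  have t_abs: "t (abs_sym_tensor p) = s p" for p
    unfolding t_def
    by (rule s_cong)
      (simp flip: sym_tensor.abs_eq_iff add: Quotient3_abs_rep[OF Quotient3_sym_tensor])
  have "linear t"
  proof (rule linearI)
    fix x y :: "'a sym_tensor" and r :: real
    obtain p q where "x = abs_sym_tensor p" "y = abs_sym_tensor q"
      by (metis Quotient3_abs_rep[OF Quotient3_sym_tensor])
    then show "t (x + y) = t x + t y" "t (r *\<^sub>R x) = r *\<^sub>R t x"
      by (simp_all add: plus_sym_tensor.abs_eq scaleR_sym_tensor.abs_eq t_abs linear_add[OF lin]
          linear_scale[OF lin])
  qed
  then show ?thesis
    by (auto simp: sym_of_eq_abs t_abs s)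
qed

section \<open>Multilinear maps on products of subspaces\<close>

text \<open>
  Projecting onto a complement extends maps on a subspace to the whole type; this is what makes
  the tensor power of the type contain the tensor products of its subspaces.
\<close>

lemma ex_projection:
  assumes "subspace V"
  shows "\<exists>p. linear p \<and> range p \<subseteq> V \<and> (\<forall>v\<in>V. p v = v)"
  using linear_exists_left_inverse_on[OF linear_id assms] by auto

text \<open>
  Zero is a consistent value on lists of the wrong length, because the multilinearity equations only
  relate lists of equal length.
\<close>

lemma multilinear_extension:
  fixes P :: "'a::real_vector set \<Rightarrow> 'a \<Rightarrow> 'a"
  assumes T: "multilinear_on Vs W T"
    and P: "\<And>V. V \<in> set Vs \<Longrightarrow> linear (P V) \<and> range (P V) \<subseteq> V"
  shows "multilinear (\<lambda>xs. if length xs = length Vs then T (map2 P Vs xs) else 0)"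
proof -
  have *: "\<exists>us vs V. V \<in> set Vs \<and> us @ V # vs = Vs \<and> length us = length xs \<and> length vs = length ys"
    if "length (xs @ x # ys) = length Vs" for xs ys :: "'a list" and x
    using that id_take_nth_drop[of "length xs" Vs]
    by (intro exI[of _ "take (length xs) Vs"] exI[of _ "drop (Suc (length xs)) Vs"]
        exI[of _ "Vs ! length xs"]) auto
  have mem: "map2 P Vs xs \<in> listset Vs" if "length xs = length Vs" for xs
    using that P by (auto simp: in_listset_iff list_all2_conv_all_nth dest!: nth_mem[of _ Vs])
  have add: "T (map2 P Vs (xs @ (x + y) # ys)) =
      T (map2 P Vs (xs @ x # ys)) + T (map2 P Vs (xs @ y # ys))"
    if len: "length (xs @ x # ys) = length Vs" for xs ys x y
  proof -
    obtain us V vs where V: "V \<in> set Vs" "us @ V # vs = Vs" "length us = length xs" "length vs = length ys"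
      using *[OF len] by metis
    have eq: "map2 P Vs (xs @ z # ys) = map2 P us xs @ P V z # map2 P vs ys" for z
      using V(3,4) by (simp flip: V(2))
    show ?thesis
      using T mem[of "xs @ x # ys"] mem[of "xs @ y # ys"] len P[OF V(1)]
      unfolding multilinear_on_def eq by (simp add: linear_add)
  qed
  have scale: "T (map2 P Vs (xs @ (r *\<^sub>R x) # ys)) = r *\<^sub>R T (map2 P Vs (xs @ x # ys))"
    if len: "length (xs @ x # ys) = length Vs" for xs ys r x
  proof -
    obtain us V vs where V: "V \<in> set Vs" "us @ V # vs = Vs" "length us = length xs" "length vs = length ys"
      using *[OF len] by metis
    have eq: "map2 P Vs (xs @ z # ys) = map2 P us xs @ P V z # map2 P vs ys" for z
      using V(3,4) by (simp flip: V(2))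
    show ?thesis
      using T mem[of "xs @ x # ys"] len P[OF V(1)]
      unfolding multilinear_on_def eq by (simp add: linear_scale)
  qed
  show ?thesis
    unfolding multilinear_def using add scale by simp
qed

lemma tensor_linearization_on:
  assumes T: "multilinear_on Vs W T" and Vs: "\<And>V. V \<in> set Vs \<Longrightarrow> subspace V"
  shows "\<exists>t. linear t \<and> (\<forall>xs\<in>listset Vs. t (tensor_of xs) = T xs)"
proof -
  obtain P where P: "\<And>V. V \<in> set Vs \<Longrightarrow> linear (P V) \<and> range (P V) \<subseteq> V \<and> (\<forall>v\<in>V. P V v = v)"
    using Vs ex_projection by metis
  have id: "map2 P Vs xs = xs" if "xs \<in> listset Vs" for xs
    using that P
    by (intro nth_equalityI) (auto simp: in_listset_iff list_all2_conv_all_nth)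
  have "\<exists>t. linear t \<and>
      (\<forall>xs. t (tensor_of xs) = (if length xs = length Vs then T (map2 P Vs xs) else 0))"
    using P by (intro tensor_linearization multilinear_extension[OF T]) auto
  then show ?thesis
    using id length_in_listset by metis
qed

text \<open>
  Both maps factor through linear maps on tensors, and these agree on a spanning set.
\<close>

lemma multilinear_on_eqI:
  assumes f: "multilinear_on (map span Ss) W f" and g: "multilinear_on (map span Ss) W' g"
    and eq: "\<And>xs. xs \<in> listset Ss \<Longrightarrow> f xs = g xs" and xs: "xs \<in> listset (map span Ss)"
  shows "f xs = g xs"
proof -
  obtain s where s: "linear s" "\<forall>xs\<in>listset (map span Ss). s (tensor_of xs) = f xs"
    using tensor_linearization_on[OF f] by auto
  obtain t where t: "linear t" "\<forall>xs\<in>listset (map span Ss). t (tensor_of xs) = g xs"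
    using tensor_linearization_on[OF g] by auto
  have "s z = t z" if "z \<in> tensor_of ` listset Ss" for z
    using that s(2) t(2) eq listset_subset_span[of Ss] by fastforce
  then have "s (tensor_of xs) = t (tensor_of xs)"
    using linear_eq_on_span[OF s(1) t(1)] span_multilinear_image[OF multilinear_tensor_of xs] by blast
  then show ?thesis
    using s(2) t(2) xs by auto
qed

text \<open>
  A permutation moves the entry in a given position to one other position and treats the remaining
  entries independently of it, so permuting the arguments keeps multilinearity.
\<close>

lemma permute_list_update:
  assumes \<sigma>: "\<sigma> permutes {..<length xs + Suc (length ys)}"
  shows "\<exists>us vs. \<forall>z. permute_list \<sigma> (xs @ z # ys) = us @ z # vs"
proof -
  define j where "j = inv \<sigma> (length xs)"
  have \<sigma>j: "\<sigma> j = length xs"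
    unfolding j_def by (rule permutes_inverses(1)[OF \<sigma>])
  have j: "j < length xs + Suc (length ys)"
    using permutes_in_image[OF \<sigma>, of j] \<sigma>j by simp
  define l where "l = permute_list \<sigma> (xs @ undefined # ys)"
  have "permute_list \<sigma> (xs @ z # ys) = take j l @ z # drop (Suc j) l" for z
  proof -
    have "permute_list \<sigma> (xs @ z # ys) = l[j := z]"
    proof (rule nth_equalityI)
      fix i assume "i < length (permute_list \<sigma> (xs @ z # ys))"
      then have i: "i < length xs + Suc (length ys)" by simp
      have "\<sigma> i = length xs \<longleftrightarrow> i = j"
        using \<sigma>j permutes_inj[OF \<sigma>] by (metis injD)
      then show "permute_list \<sigma> (xs @ z # ys) ! i = l[j := z] ! i"
        using i \<sigma> by (auto simp: l_def permute_list_nth nth_list_update nth_append nth_Cons')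
    qed (simp add: l_def)
    then show ?thesis
      using j by (simp add: upd_conv_take_nth_drop l_def)
  qed
  then show ?thesis by blast
qed

lemma multilinear_on_permute:
  assumes T: "multilinear_on (replicate n V) W T" and \<sigma>: "\<sigma> permutes {..<n}"
  shows "multilinear_on (replicate n V) W (\<lambda>xs. T (permute_list \<sigma> xs))"
proof -
  have mem: "permute_list \<sigma> xs \<in> listset (replicate n V) \<longleftrightarrow> xs \<in> listset (replicate n V)" for xs
    using \<sigma> by (auto simp: in_listset_replicate)
  have split: "\<exists>us vs. \<forall>z. permute_list \<sigma> (xs @ z # ys) = us @ z # vs"
    if "xs @ x # ys \<in> listset (replicate n V)" for xs x ys
    using permute_list_update[of \<sigma> xs ys] \<sigma> length_in_listset[OF that] by simp
  show ?thesis
    unfolding multilinear_on_def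
  proof (intro conjI allI ballI impI)
    fix xs assume "xs \<in> listset (replicate n V)"
    then show "T (permute_list \<sigma> xs) \<in> W"
      using T mem by (auto simp: multilinear_on_def)
  next
    fix xs x y ys
    assume *: "xs @ x # ys \<in> listset (replicate n V) \<and> xs @ y # ys \<in> listset (replicate n V)"
    then obtain us vs where eq: "\<And>z. permute_list \<sigma> (xs @ z # ys) = us @ z # vs"
      using split by blast
    have "us @ x # vs \<in> listset (replicate n V)" "us @ y # vs \<in> listset (replicate n V)"
      using * mem by (simp_all flip: eq)
    then show "T (permute_list \<sigma> (xs @ (x + y) # ys)) =
        T (permute_list \<sigma> (xs @ x # ys)) + T (permute_list \<sigma> (xs @ y # ys))"
      using T by (simp add: eq multilinear_on_def)
  next
    fix xs r x ys
    assume *: "xs @ x # ys \<in> listset (replicate n V)"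
    then obtain us vs where eq: "\<And>z. permute_list \<sigma> (xs @ z # ys) = us @ z # vs"
      using split by blast
    have "us @ x # vs \<in> listset (replicate n V)"
      using * mem by (simp flip: eq)
    then show "T (permute_list \<sigma> (xs @ (r *\<^sub>R x) # ys)) = r *\<^sub>R T (permute_list \<sigma> (xs @ x # ys))"
      using T by (simp add: eq multilinear_on_def)
  qed
qed

text \<open>
  All factors are the same subspace, so that one projection can be applied to every entry; this
  makes the extension commute with permutations and inherit the symmetry.
\<close>

lemma sym_linearization_on:
  assumes T: "multilinear_on (replicate n V) W T" and V: "subspace V"
    and sym: "\<And>\<sigma> xs. \<sigma> permutes {..<n} \<Longrightarrow> xs \<in> listset (replicate n V) \<Longrightarrow>
      T (permute_list \<sigma> xs) = T xs"
  shows "\<exists>t. linear t \<and> (\<forall>xs\<in>listset (replicate n V). t (sym_of xs) = T xs)"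
proof -
  obtain p where p: "linear p" "range p \<subseteq> V" "\<forall>v\<in>V. p v = v"
    using ex_projection[OF V] by blast
  define T' where "T' xs = (if length xs = n then T (map p xs) else 0)" for xs
  have map2: "map2 (\<lambda>_. p) (replicate n V) xs = map p xs" if "length xs = n" for xs
    using that by (intro nth_equalityI) auto
  have T': "T' = (\<lambda>xs. if length xs = length (replicate n V)
      then T (map2 (\<lambda>_. p) (replicate n V) xs) else 0)"
    by (rule ext) (simp add: T'_def map2)
  have "\<exists>t. linear t \<and> (\<forall>xs. t (sym_of xs) = T' xs)"
  proof (rule sym_linearization)
    show "multilinear T'"
      unfolding T' using p by (intro multilinear_extension[OF T]) auto
    show "T' (permute_list \<sigma> xs) = T' xs" if "\<sigma> permutes {..<length xs}" for \<sigma> xs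
    proof (cases "length xs = n")
      case True
      then have "map p xs \<in> listset (replicate n V)"
        using p(2) by (auto simp: in_listset_replicate)
      with True that show ?thesis
        by (simp add: T'_def sym flip: permute_list_map)
    qed (simp add: T'_def)
  qed
  moreover have "T' xs = T xs" if "xs \<in> listset (replicate n V)" for xs
  proof -
    have "map p xs = xs"
      using that p(3) by (intro map_idI) (auto simp: in_listset_replicate)
    then show ?thesis
      using that by (simp add: T'_def in_listset_replicate)
  qed
  ultimately show ?thesis by metis
qed

section \<open>Linear maps and morphisms of cones\<close>

lemma linear_maps_restrict_span:
  assumes f: "linear f" and W: "subspace W" and S: "f ` S \<subseteq> W"
  shows "(\<lambda>x. if x \<in> span S then f x else 0) \<in> linear_maps (span S) W"
proof -
  have "span S \<subseteq> f -` W"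
    using S by (intro span_minimal linear_subspace_vimage[OF f W]) auto
  then show ?thesis
    by (auto simp: linear_maps_def linear_add[OF f] linear_scale[OF f] span_add span_scale)
qed

text \<open>
  Agreement outside the span is automatic: there both functions are zero.
\<close>

lemma linear_maps_eqI:
  assumes f: "f \<in> linear_maps (span S) W" and g: "g \<in> linear_maps (span S) W'"
    and eq: "\<And>x. x \<in> S \<Longrightarrow> f x = g x"
  shows "f = g"
proof
  fix x
  show "f x = g x"
  proof (cases "x \<in> span S")
    case True
    have "f 0 = 0 *\<^sub>R f 0" "g 0 = 0 *\<^sub>R g 0"
      using f g span_zero[of S] unfolding linear_maps_def by (metis (mono_tags, lifting) mem_Collect_eq scale_zero_right)+
    then have "subspace {x \<in> span S. f x = g x}"
      using f g by (auto simp: subspace_def linear_maps_def span_zero span_add span_scale)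
    from span_induct[OF True this] show ?thesis
      using eq span_base by auto
  qed (use f g in \<open>auto simp: linear_maps_def\<close>)
qed

lemma linear_maps_0: "f \<in> linear_maps V W \<Longrightarrow> subspace V \<Longrightarrow> f 0 = 0"
  using subspace_0[of V] unfolding linear_maps_def
  by (metis (mono_tags, lifting) mem_Collect_eq scale_zero_left)

lemma linear_maps_in: "f \<in> linear_maps V W \<Longrightarrow> x \<in> V \<Longrightarrow> f x \<in> W"
  and linear_maps_add: "f \<in> linear_maps V W \<Longrightarrow> x \<in> V \<Longrightarrow> y \<in> V \<Longrightarrow> f (x + y) = f x + f y"
  and linear_maps_scaleR: "f \<in> linear_maps V W \<Longrightarrow> x \<in> V \<Longrightarrow> f (r *\<^sub>R x) = r *\<^sub>R f x"
  and linear_maps_outside: "f \<in> linear_maps V W \<Longrightarrow> x \<notin> V \<Longrightarrow> f x = 0"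
  by (auto simp: linear_maps_def)

lemma subspace_linear_maps: "subspace W \<Longrightarrow> subspace (linear_maps V W)"
  by (auto simp: subspace_def linear_maps_def scaleR_fun_def zero_fun_def plus_fun_def
      algebra_simps)

lemma Hom_AC_imp_linear: "f \<in> Hom_AC X Y \<Longrightarrow> f \<in> linear_maps (L X) (L Y)"
  by (simp add: Hom_AC_def)

lemma AC_D:
  assumes "X \<in> AC"
  shows "subspace (L X)" "cone_of X \<subseteq> L X" "convex_cone (cone_of X)" "span (cone_of X) = L X"
  using assms by (auto simp: AC_def)

lemma map_L_AC: "set Cs \<subseteq> AC \<Longrightarrow> map L Cs = map span (map cone_of Cs)"
  using AC_D(4) by (fastforce simp del: split_paired_All)

lemma image_convex_cone_hull_subset:
  assumes f: "f \<in> linear_maps V W" and V: "subspace V" "S \<subseteq> V" and D: "convex_cone D"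
    and S: "f ` S \<subseteq> D"
  shows "f ` (convex_cone hull S) \<subseteq> D"
proof -
  have "convex_cone {x \<in> V. f x \<in> D}"
    unfolding convex_cone_iff
    using f V(1) D linear_maps_0[OF f V(1)]
    by (auto simp: linear_maps_def subspace_add subspace_scale subspace_0 convex_cone_add
        convex_cone_scaleR convex_cone_contains_0)
  then have "convex_cone hull S \<subseteq> {x \<in> V. f x \<in> D}"
    using S V(2) by (intro hull_minimal) auto
  then show ?thesis by auto
qed

text \<open>
  The common core of both universal properties, with \<open>e\<close> standing for the product map \<open>tensor_of\<close>
  or \<open>sym_of\<close>.  The linear map \<open>t\<close> on the whole type is cut down to the span of the products;
  full-dimensionality of the cones makes this the same as the span of the generators of the product
  cone, where the values of a morphism are prescribed.
\<close>

lemma cone_linearization: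
  assumes e: "multilinear e" and Cs: "set Cs \<subseteq> AC" and D: "D \<in> AC"
    and T: "multilinear_on (map L Cs) (L D) T" "T ` listset (map cone_of Cs) \<subseteq> cone_of D"
    and t: "linear t" "\<And>xs. xs \<in> listset (map L Cs) \<Longrightarrow> t (e xs) = T xs"
  shows "\<exists>!s. s \<in> Hom_AC (convex_cone hull (e ` listset (map cone_of Cs)),
      span (e ` listset (map L Cs))) D \<and> (\<forall>xs\<in>listset (map cone_of Cs). T xs = s (e xs))"
proof -
  let ?G = "e ` listset (map cone_of Cs)" and ?V = "span (e ` listset (map L Cs))"
  have V: "?V = span ?G"
    unfolding map_L_AC[OF Cs] by (rule span_multilinear_image_eq[OF e])
  have sub: "listset (map cone_of Cs) \<subseteq> listset (map L Cs)"
    unfolding map_L_AC[OF Cs] by (rule listset_subset_span)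
  define s where "s = (\<lambda>x. if x \<in> ?V then t x else 0)"
  have s: "s \<in> linear_maps ?V (L D)"
    unfolding s_def using t(2) T(1)
    by (intro linear_maps_restrict_span[OF t(1) AC_D(1)[OF D]]) (auto simp: multilinear_on_def)
  have se: "s (e xs) = T xs" if "xs \<in> listset (map cone_of Cs)" for xs
    using that sub t(2) by (auto simp: s_def span_base)
  have "s ` (convex_cone hull ?G) \<subseteq> cone_of D"
    using T(2) se AC_D(3)[OF D] by (intro image_convex_cone_hull_subset[OF s]) (auto simp: V span_base)
  with s se show ?thesis
  proof (intro ex1I[of _ s], goal_cases)
    case 1
    then show ?case by (auto simp: Hom_AC_def)
  next
    case (2 s')
    then have "s' \<in> linear_maps (span ?G) (L D)"
      by (auto simp: Hom_AC_def V)
    moreover have "s \<in> linear_maps (span ?G) (L D)"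
      using s by (simp add: V)
    ultimately show ?case
      by (rule linear_maps_eqI) (use 2 se in auto)
  qed
qed

theorem Tensor_universal:
  assumes Cs: "set Cs \<subseteq> AC" and D: "D \<in> AC" and T: "multilinear_AC Cs D T"
  shows "\<exists>!t. t \<in> Hom_AC (Tensor Cs) D \<and> (\<forall>xs\<in>listset (map cone_of Cs). T xs = t (tensor_of xs))"
proof -
  obtain T' where T': "multilinear_on (map L Cs) (L D) T'" "T' ` listset (map cone_of Cs) \<subseteq> cone_of D"
    and eq: "\<forall>xs\<in>listset (map cone_of Cs). T xs = T' xs"
    using T by (auto simp: multilinear_AC_def)
  obtain t where "linear t" "\<forall>xs\<in>listset (map L Cs). t (tensor_of xs) = T' xs"
    using tensor_linearization_on[OF T'(1)] Cs AC_D(1) by force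
  with cone_linearization[OF multilinear_tensor_of Cs D T'] show ?thesis
    using eq by (simp add: Tensor_def)
qed

theorem Sym_universal:
  assumes X: "X \<in> AC" and D: "D \<in> AC" and T: "multilinear_AC (replicate n X) D T"
    and sym: "symmetric_AC n X T"
  shows "\<exists>!t. t \<in> Hom_AC (Sym n X) D \<and>
    (\<forall>xs\<in>listset (replicate n (cone_of X)). T xs = t (sym_of xs))"
proof -
  let ?Cs = "replicate n X"
  have Cs: "set ?Cs \<subseteq> AC" using X by auto
  obtain T' where T': "multilinear_on (map L ?Cs) (L D) T'" "T' ` listset (map cone_of ?Cs) \<subseteq> cone_of D"
    and eq: "\<forall>xs\<in>listset (replicate n (cone_of X)). T xs = T' xs"
    using T by (auto simp: multilinear_AC_def)
  have span: "replicate n (L X) = map span (replicate n (cone_of X))"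
    by (simp add: AC_D(4)[OF X])
  have mult: "multilinear_on (replicate n (L X)) (L D) T'"
    using T'(1) by simp
  have "T' (permute_list \<sigma> xs) = T' xs"
    if \<sigma>: "\<sigma> permutes {..<n}" and xs: "xs \<in> listset (replicate n (L X))" for \<sigma> xs
  proof (rule multilinear_on_eqI)
    show "multilinear_on (map span (replicate n (cone_of X))) (L D) (\<lambda>xs. T' (permute_list \<sigma> xs))"
      using multilinear_on_permute[OF mult \<sigma>] by (simp only: span)
    show "multilinear_on (map span (replicate n (cone_of X))) (L D) T'"
      using mult by (simp only: span)
    show "xs \<in> listset (map span (replicate n (cone_of X)))"
      using xs by (simp only: span)
    fix ys assume ys: "ys \<in> listset (replicate n (cone_of X))"
    then have "permute_list \<sigma> ys \<in> listset (replicate n (cone_of X))"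
      using \<sigma> by (auto simp: in_listset_replicate)
    with ys \<sigma> sym eq show "T' (permute_list \<sigma> ys) = T' ys"
      by (metis symmetric_AC_def)
  qed
  then obtain t where "linear t" "\<forall>xs\<in>listset (replicate n (L X)). t (sym_of xs) = T' xs"
    using sym_linearization_on[OF mult AC_D(1)[OF X]] by blast
  with cone_linearization[OF multilinear_sym_of Cs D T'] show ?thesis
    using eq by (simp add: Sym_def)
qed

section \<open>The adjunction\<close>

lemma in_listset_pair: "xs \<in> listset [V, W] \<longleftrightarrow> (\<exists>a\<in>V. \<exists>b\<in>W. xs = [a, b])"
  by (auto simp: set_Cons_def)

lemma bilinear_linearization:
  assumes V: "subspace V\<^sub>1" "subspace V\<^sub>2" and W: "subspace W"
    and F: "\<And>a b. a \<in> V\<^sub>1 \<Longrightarrow> b \<in> V\<^sub>2 \<Longrightarrow> F a b \<in> W"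
    "\<And>a a' b. a \<in> V\<^sub>1 \<Longrightarrow> a' \<in> V\<^sub>1 \<Longrightarrow> b \<in> V\<^sub>2 \<Longrightarrow> F (a + a') b = F a b + F a' b"
    "\<And>r a b. a \<in> V\<^sub>1 \<Longrightarrow> b \<in> V\<^sub>2 \<Longrightarrow> F (r *\<^sub>R a) b = r *\<^sub>R F a b"
    "\<And>a b b'. a \<in> V\<^sub>1 \<Longrightarrow> b \<in> V\<^sub>2 \<Longrightarrow> b' \<in> V\<^sub>2 \<Longrightarrow> F a (b + b') = F a b + F a b'"
    "\<And>r a b. a \<in> V\<^sub>1 \<Longrightarrow> b \<in> V\<^sub>2 \<Longrightarrow> F a (r *\<^sub>R b) = r *\<^sub>R F a b"
  shows "\<exists>!t. t \<in> linear_maps (span (tensor_of ` listset [V\<^sub>1, V\<^sub>2])) W \<and>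
    (\<forall>a\<in>V\<^sub>1. \<forall>b\<in>V\<^sub>2. t (tensor_of [a, b]) = F a b)"
proof -
  let ?V = "span (tensor_of ` listset [V\<^sub>1, V\<^sub>2])"
  define T where "T xs = F (xs ! 0) (xs ! 1)" for xs
  have "multilinear_on [V\<^sub>1, V\<^sub>2] W T"
    unfolding multilinear_on_def Ball_def in_listset_pair T_def
    using F by (auto simp: append_eq_Cons_conv Cons_eq_append_conv)
  then obtain t where t: "linear t" "\<forall>xs\<in>listset [V\<^sub>1, V\<^sub>2]. t (tensor_of xs) = T xs"
    using tensor_linearization_on V by fastforce
  have tF: "t (tensor_of [a, b]) = F a b" if "a \<in> V\<^sub>1" "b \<in> V\<^sub>2" for a b
    using t(2) that by (simp add: T_def set_Cons_def)
  define s where "s = (\<lambda>x. if x \<in> ?V then t x else 0)"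
  have s: "s \<in> linear_maps ?V W"
    unfolding s_def using F(1) tF
    by (intro linear_maps_restrict_span[OF t(1) W]) (auto simp: set_Cons_def)
  have sF: "s (tensor_of [a, b]) = F a b" if "a \<in> V\<^sub>1" "b \<in> V\<^sub>2" for a b
    using tF that unfolding s_def by (auto simp: set_Cons_def intro: span_base)
  show ?thesis
  proof (intro ex1I[of _ s] conjI ballI)
    fix s' assume "s' \<in> linear_maps ?V W \<and> (\<forall>a\<in>V\<^sub>1. \<forall>b\<in>V\<^sub>2. s' (tensor_of [a, b]) = F a b)"
    then show "s' = s"
      using sF by (intro linear_maps_eqI[OF _ s]) (auto simp: set_Cons_def)
  qed (use s sF in auto)
qed

text \<open>
  A linear bijection has a linear inverse, but its inverse preserves cones only if the bijection
  also reflects membership in them.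
\<close>

lemma iso_AC_I:
  assumes f: "f \<in> Hom_AC X Y" and X: "subspace (L X)" and bij: "bij_betw f (L X) (L Y)"
    and Y: "cone_of Y \<subseteq> L Y"
    and reflect: "\<And>x. x \<in> L X \<Longrightarrow> f x \<in> cone_of Y \<Longrightarrow> x \<in> cone_of X"
  shows "iso_AC X Y f"
proof -
  have lin: "f \<in> linear_maps (L X) (L Y)" using f by (rule Hom_AC_imp_linear)
  define h where "h = inv_into (L X) f"
  have hX: "h y \<in> L X" and fh: "f (h y) = y" if "y \<in> L Y" for y
    using that bij unfolding h_def
    by (simp_all add: bij_betw_def inv_into_into f_inv_into_f)
  have hf: "h (f x) = x" if "x \<in> L X" for x
    using that bij unfolding h_def by (simp add: bij_betw_def inv_into_f_f)
  define g where "g y = (if y \<in> L Y then h y else 0)" for y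
  have add: "y + y' \<in> L Y \<and> h (y + y') = h y + h y'" if "y \<in> L Y" "y' \<in> L Y" for y y'
  proof -
    have *: "f (h y + h y') = y + y'" "h y + h y' \<in> L X"
      using that hX fh X by (simp_all add: linear_maps_add[OF lin] subspace_add)
    then show ?thesis using hf linear_maps_in[OF lin] by metis
  qed
  have scale: "r *\<^sub>R y \<in> L Y \<and> h (r *\<^sub>R y) = r *\<^sub>R h y" if "y \<in> L Y" for r y
  proof -
    have *: "f (r *\<^sub>R h y) = r *\<^sub>R y" "r *\<^sub>R h y \<in> L X"
      using that hX fh X by (simp_all add: linear_maps_scaleR[OF lin] subspace_scale)
    then show ?thesis using hf linear_maps_in[OF lin] by metis
  qed
  have "g \<in> linear_maps (L Y) (L X)"
    using hX add scale by (auto simp: linear_maps_def g_def)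
  moreover have "g ` cone_of Y \<subseteq> cone_of X"
    using Y reflect hX fh by (auto simp: g_def)
  ultimately have "g \<in> Hom_AC Y X" by (simp add: Hom_AC_def)
  moreover have "\<forall>x\<in>L X. g (f x) = x"
    using hf linear_maps_in[OF lin] by (simp add: g_def)
  moreover have "\<forall>y\<in>L Y. f (g y) = y"
    using fh by (simp add: g_def)
  ultimately show ?thesis
    using f unfolding iso_AC_def by blast
qed

lemma tensor_of_pair:
  fixes a :: "'a::real_vector"
  shows "tensor_of [a + a', b] = tensor_of [a, b] + tensor_of [a', b]"
    "tensor_of [a, b + b'] = tensor_of [a, b] + tensor_of [a, b']"
    "tensor_of [r *\<^sub>R a, b] = r *\<^sub>R tensor_of [a, b]"
    "tensor_of [a, r *\<^sub>R b] = r *\<^sub>R tensor_of [a, b]"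
proof -
  have add: "tensor_of (xs @ (x + y) # ys) = tensor_of (xs @ x # ys) + tensor_of (xs @ y # ys)"
    and scale: "tensor_of (xs @ (r *\<^sub>R x) # ys) = r *\<^sub>R tensor_of (xs @ x # ys)" for r ys and xs :: "'a list" and x y
    using multilinear_tensor_of[where ?'a = 'a] by (auto simp: multilinear_def)
  show "tensor_of [a + a', b] = tensor_of [a, b] + tensor_of [a', b]"
    "tensor_of [a, b + b'] = tensor_of [a, b] + tensor_of [a, b']"
    "tensor_of [r *\<^sub>R a, b] = r *\<^sub>R tensor_of [a, b]"
    "tensor_of [a, r *\<^sub>R b] = r *\<^sub>R tensor_of [a, b]"
    using add[of "[]"] add[of "[a]"] scale[of "[]"] scale[of "[a]"] by simp_all
qed

lemma tensor_of_in_Tensor: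
  "a \<in> L A \<Longrightarrow> b \<in> L B \<Longrightarrow> tensor_of [a, b] \<in> L (Tensor [A, B])"
  "a \<in> cone_of A \<Longrightarrow> b \<in> cone_of B \<Longrightarrow> tensor_of [a, b] \<in> cone_of (Tensor [A, B])"
  unfolding Tensor_def by (auto simp: set_Cons_def intro!: span_base hull_inc)

lemma subspace_Tensor: "subspace (L (Tensor Cs))"
  by (simp add: Tensor_def)

lemma curry_in_linear_maps:
  assumes A: "subspace (L A)" and B: "subspace (L B)"
    and f: "f \<in> linear_maps (L (Tensor [A, B])) (L C)"
  shows "curry_AC A B C f \<in> linear_maps (L A) (linear_maps (L B) (L C))"
proof -
  note [simp] = subspace_add[OF A] subspace_add[OF B] subspace_scale[OF A] subspace_scale[OF B]
    tensor_of_in_Tensor tensor_of_pair linear_maps_add[OF f] linear_maps_scaleR[OF f]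
    linear_maps_in[OF f]
  have curry: "curry_AC A B C f = (\<lambda>a b. if a \<in> L A \<and> b \<in> L B then f (tensor_of [a, b]) else 0)"
    using f by (intro ext) (simp add: curry_AC_def Hom_cone_def)
  show ?thesis
    unfolding curry linear_maps_def
    by (auto simp: fun_eq_iff scaleR_fun_def)
qed

lemma curry_apply:
  "f \<in> linear_maps (L (Tensor [A, B])) (L C) \<Longrightarrow> a \<in> L A \<Longrightarrow> b \<in> L B \<Longrightarrow>
    curry_AC A B C f a b = f (tensor_of [a, b])"
  by (simp add: curry_AC_def Hom_cone_def)

lemma curry_linear:
  assumes A: "subspace (L A)" and B: "subspace (L B)" and C: "subspace (L C)"
  shows "curry_AC A B C \<in> linear_maps (linear_maps (L (Tensor [A, B])) (L C))
    (linear_maps (L A) (linear_maps (L B) (L C)))"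
proof -
  have S: "subspace (linear_maps (L (Tensor [A, B])) (L C))"
    by (rule subspace_linear_maps[OF C])
  show ?thesis
    unfolding linear_maps_def[of "linear_maps (L (Tensor [A, B])) (L C)"]
    using curry_in_linear_maps[OF A B, of _ C] subspace_add[OF S] subspace_scale[OF S]
    by (auto simp: fun_eq_iff scaleR_fun_def curry_AC_def Hom_cone_def)
qed

text \<open>
  Injectivity holds because the \<open>a \<otimes> b\<close> span; a preimage of \<open>F\<close> is the linearization of the
  bilinear map \<open>(a, b) \<mapsto> F a b\<close>.
\<close>

lemma bij_curry:
  assumes A: "subspace (L A)" and B: "subspace (L B)" and C: "subspace (L C)"
  shows "bij_betw (curry_AC A B C) (linear_maps (L (Tensor [A, B])) (L C))
    (linear_maps (L A) (linear_maps (L B) (L C)))"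
  unfolding bij_betw_def
proof
  let ?H = "linear_maps (L (Tensor [A, B])) (L C)"
  show "inj_on (curry_AC A B C) ?H"
  proof (rule inj_onI)
    fix f g assume f: "f \<in> ?H" and g: "g \<in> ?H" and eq: "curry_AC A B C f = curry_AC A B C g"
    have "f (tensor_of [a, b]) = g (tensor_of [a, b])" if "a \<in> L A" "b \<in> L B" for a b
      using eq curry_apply[OF f that] curry_apply[OF g that] by simp
    then show "f = g"
      using f g unfolding Tensor_def by (auto simp: set_Cons_def intro!: linear_maps_eqI)
  qed
  have "F \<in> curry_AC A B C ` ?H" if F: "F \<in> linear_maps (L A) (linear_maps (L B) (L C))" for F
  proof -
    note Fa = linear_maps_in[OF F]
    have "\<exists>!t. t \<in> linear_maps (span (tensor_of ` listset [L A, L B])) (L C) \<and>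
        (\<forall>a\<in>L A. \<forall>b\<in>L B. t (tensor_of [a, b]) = F a b)"
      using linear_maps_in[OF Fa] linear_maps_add[OF Fa] linear_maps_scaleR[OF Fa]
      by (intro bilinear_linearization A B C)
        (simp_all add: linear_maps_add[OF F] linear_maps_scaleR[OF F] scaleR_fun_def)
    then obtain t where t: "t \<in> ?H" "\<forall>a\<in>L A. \<forall>b\<in>L B. t (tensor_of [a, b]) = F a b"
      by (auto simp: Tensor_def)
    have "curry_AC A B C t a b = F a b" for a b
    proof (cases "a \<in> L A \<and> b \<in> L B")
      case True
      then show ?thesis using t curry_apply[OF t(1)] by simp
    next
      case False
      then have "F a b = 0"
        using linear_maps_outside[OF F, of a] linear_maps_outside[OF Fa, of a b] by fastforce
      with False show ?thesis by (auto simp: curry_AC_def)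
    qed
    then have "curry_AC A B C t = F" by (intro ext)
    with t(1) show ?thesis by blast
  qed
  with curry_in_linear_maps[OF A B]
  show "curry_AC A B C ` ?H = linear_maps (L A) (linear_maps (L B) (L C))"
    by blast
qed

text \<open>
  Both sides say that \<open>f (a \<otimes> b) \<in> C\<close> for all \<open>a \<in> A\<close> and \<open>b \<in> B\<close>: on the left by the meaning
  of the cone \<open>Hom(B, C)\<close>, on the right because these \<open>a \<otimes> b\<close> generate \<open>A \<otimes> B\<close>.
\<close>

lemma curry_in_cone_iff:
  assumes A: "A \<in> AC" and B: "B \<in> AC" and C: "C \<in> AC"
    and f: "f \<in> linear_maps (L (Tensor [A, B])) (L C)"
  shows "curry_AC A B C f \<in> Hom_AC A (Hom_cone B C) \<longleftrightarrow> f \<in> Hom_AC (Tensor [A, B]) C"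
proof -
  note lin = curry_in_linear_maps[OF AC_D(1)[OF A] AC_D(1)[OF B] f]
  have "curry_AC A B C f \<in> Hom_AC A (Hom_cone B C) \<longleftrightarrow>
      (\<forall>a\<in>cone_of A. curry_AC A B C f a ` cone_of B \<subseteq> cone_of C)"
    using lin linear_maps_in[OF lin] AC_D(2)[OF A]
    unfolding Hom_AC_def Hom_cone_def image_subset_iff by auto
  also have "\<dots> \<longleftrightarrow> (\<forall>a\<in>cone_of A. \<forall>b\<in>cone_of B. f (tensor_of [a, b]) \<in> cone_of C)"
  proof -
    have "curry_AC A B C f a b = f (tensor_of [a, b])" if "a \<in> cone_of A" "b \<in> cone_of B" for a b
      using that AC_D(2)[OF A] AC_D(2)[OF B] by (intro curry_apply f) auto
    then show ?thesis by (simp add: image_subset_iff)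
  qed
  also have "\<dots> \<longleftrightarrow> f ` cone_of (Tensor [A, B]) \<subseteq> cone_of C"
  proof
    assume *: "\<forall>a\<in>cone_of A. \<forall>b\<in>cone_of B. f (tensor_of [a, b]) \<in> cone_of C"
    have "tensor_of ` listset (map cone_of [A, B]) \<subseteq> L (Tensor [A, B])"
      using AC_D(2)[OF A] AC_D(2)[OF B] by (auto simp: set_Cons_def intro!: tensor_of_in_Tensor)
    with * have "f ` (convex_cone hull (tensor_of ` listset (map cone_of [A, B]))) \<subseteq> cone_of C"
      by (intro image_convex_cone_hull_subset[OF f subspace_Tensor] AC_D(3)[OF C])
        (auto simp: set_Cons_def)
    then show "f ` cone_of (Tensor [A, B]) \<subseteq> cone_of C"
      by (simp add: Tensor_def)
  qed (use tensor_of_in_Tensor(2) in blast)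
  also have "\<dots> \<longleftrightarrow> f \<in> Hom_AC (Tensor [A, B]) C"
    using f by (simp add: Hom_AC_def)
  finally show ?thesis .
qed

theorem curry_iso:
  assumes A: "A \<in> AC" and B: "B \<in> AC" and C: "C \<in> AC"
  shows "iso_AC (Hom_cone (Tensor [A, B]) C) (Hom_cone A (Hom_cone B C)) (curry_AC A B C)"
proof (rule iso_AC_I)
  note sub = AC_D(1)[OF A] AC_D(1)[OF B] AC_D(1)[OF C]
  show "curry_AC A B C \<in> Hom_AC (Hom_cone (Tensor [A, B]) C) (Hom_cone A (Hom_cone B C))"
    unfolding Hom_AC_def[of "Hom_cone _ _"]
    using curry_linear[OF sub] curry_in_cone_iff[OF A B C] Hom_AC_imp_linear
    by (fastforce simp: Hom_cone_def)
  show "subspace (L (Hom_cone (Tensor [A, B]) C))"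
    using subspace_linear_maps[OF sub(3)] by (simp add: Hom_cone_def)
  show "bij_betw (curry_AC A B C) (L (Hom_cone (Tensor [A, B]) C)) (L (Hom_cone A (Hom_cone B C)))"
    using bij_curry[OF sub] by (simp add: Hom_cone_def)
  show "cone_of (Hom_cone A (Hom_cone B C)) \<subseteq> L (Hom_cone A (Hom_cone B C))"
    by (auto simp: Hom_cone_def Hom_AC_def)
  show "f \<in> cone_of (Hom_cone (Tensor [A, B]) C)"
    if "f \<in> L (Hom_cone (Tensor [A, B]) C)"
      "curry_AC A B C f \<in> cone_of (Hom_cone A (Hom_cone B C))" for f
    using that curry_in_cone_iff[OF A B C, of f] by (simp add: Hom_cone_def)
qed

text \<open>
  The definite description defining \<open>\<alpha> \<otimes> \<beta>\<close> is meaningful because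
  \<open>(a, b) \<mapsto> \<alpha> a \<otimes> \<beta> b\<close> is bilinear.
\<close>

lemma tensor_map_works:
  assumes sub: "subspace (L A')" "subspace (L B')"
    and \<alpha>: "\<alpha> \<in> linear_maps (L A') (L A)" and \<beta>: "\<beta> \<in> linear_maps (L B') (L B)"
  shows "tensor_map A' B' A B \<alpha> \<beta> \<in> linear_maps (L (Tensor [A', B'])) (L (Tensor [A, B])) \<and>
    (\<forall>a\<in>L A'. \<forall>b\<in>L B'. tensor_map A' B' A B \<alpha> \<beta> (tensor_of [a, b]) = tensor_of [\<alpha> a, \<beta> b])"
proof -
  have "\<exists>!t. t \<in> linear_maps (span (tensor_of ` listset [L A', L B'])) (L (Tensor [A, B])) \<and>
      (\<forall>a\<in>L A'. \<forall>b\<in>L B'. t (tensor_of [a, b]) = tensor_of [\<alpha> a, \<beta> b])"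
    by (intro bilinear_linearization sub subspace_Tensor tensor_of_in_Tensor)
      (simp_all add: linear_maps_in[OF \<alpha>] linear_maps_in[OF \<beta>] linear_maps_add[OF \<alpha>]
        linear_maps_add[OF \<beta>] linear_maps_scaleR[OF \<alpha>] linear_maps_scaleR[OF \<beta>] tensor_of_pair)
  then have "\<exists>!t. t \<in> linear_maps (L (Tensor [A', B'])) (L (Tensor [A, B])) \<and>
      (\<forall>a\<in>L A'. \<forall>b\<in>L B'. t (tensor_of [a, b]) = tensor_of [\<alpha> a, \<beta> b])"
    by (simp add: Tensor_def)
  then show ?thesis
    unfolding tensor_map_def by (rule theI')
qed

text \<open>
  On \<open>LA' \<times> LB'\<close> both sides are \<open>\<gamma> (f (\<alpha> a \<otimes> \<beta> b))\<close>.  Elsewhere the left side is zero by the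
  convention for linear maps, and so is the right side, since \<open>\<alpha> a\<close> or \<open>\<beta> b\<close> vanishes.
\<close>

theorem curry_natural:
  assumes sub: "subspace (L A')" "subspace (L B')" "subspace (L A)" "subspace (L B)" "subspace (L C)"
    and \<alpha>: "\<alpha> \<in> linear_maps (L A') (L A)" and \<beta>: "\<beta> \<in> linear_maps (L B') (L B)"
    and \<gamma>: "\<gamma> \<in> linear_maps (L C) (L C')" and f: "f \<in> linear_maps (L (Tensor [A, B])) (L C)"
  shows "curry_AC A' B' C' (\<gamma> \<circ> f \<circ> tensor_map A' B' A B \<alpha> \<beta>) =
    (\<lambda>a. \<gamma> \<circ> curry_AC A B C f (\<alpha> a) \<circ> \<beta>)"
proof (intro ext)
  fix a b
  let ?m = "tensor_map A' B' A B \<alpha> \<beta>"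
  have m: "?m \<in> linear_maps (L (Tensor [A', B'])) (L (Tensor [A, B]))"
    "\<And>a b. a \<in> L A' \<Longrightarrow> b \<in> L B' \<Longrightarrow> ?m (tensor_of [a, b]) = tensor_of [\<alpha> a, \<beta> b]"
    using tensor_map_works[OF sub(1,2) \<alpha> \<beta>] by auto
  have zero: "f 0 = 0" "\<gamma> 0 = 0"
    using linear_maps_0[OF f subspace_Tensor] linear_maps_0[OF \<gamma> sub(5)] .
  have comp: "\<gamma> \<circ> f \<circ> ?m \<in> linear_maps (L (Tensor [A', B'])) (L C')"
    using m(1) f \<gamma> zero by (simp add: linear_maps_def)
  note curry = curry_in_linear_maps[OF sub(3,4) f]
  show "curry_AC A' B' C' (\<gamma> \<circ> f \<circ> ?m) a b = (\<gamma> \<circ> curry_AC A B C f (\<alpha> a) \<circ> \<beta>) b"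
  proof (cases "a \<in> L A' \<and> b \<in> L B'")
    case True
    then show ?thesis
      using curry_apply[OF comp] curry_apply[OF f] linear_maps_in[OF \<alpha>] linear_maps_in[OF \<beta>] m(2)
      by simp
  next
    case False
    then consider "\<alpha> a = 0" | "a \<in> L A'" "\<beta> b = 0"
      using linear_maps_outside[OF \<alpha>] linear_maps_outside[OF \<beta>] by blast
    then have "curry_AC A B C f (\<alpha> a) (\<beta> b) = 0"
    proof cases
      case 1
      then show ?thesis using linear_maps_0[OF curry sub(3)] by simp
    next
      case 2
      then show ?thesis
        using linear_maps_0[OF linear_maps_in[OF curry linear_maps_in[OF \<alpha>]] sub(4)] by simp
    qed
    with False zero show ?thesis by (auto simp: curry_AC_def)
  qed
qed

theorem theorem3p3:
  fixes n :: nat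
  assumes "n > 0"
  shows
    "(\<forall>(Cs :: 'a::real_vector conic_space list) (D :: 'd::real_vector conic_space) T.
       length Cs = n \<and> set Cs \<subseteq> AC \<and> D \<in> AC \<and> multilinear_AC Cs D T \<longrightarrow>
       (\<exists>!t. t \<in> Hom_AC (Tensor Cs) D \<and>
             (\<forall>xs\<in>listset (map cone_of Cs). T xs = t (tensor_of xs))))
     \<and>
     (\<forall>(C\<^sub>1 :: 'a conic_space) (D :: 'd conic_space) T.
       C\<^sub>1 \<in> AC \<and> D \<in> AC \<and> multilinear_AC (replicate n C\<^sub>1) D T \<and> symmetric_AC n C\<^sub>1 T \<longrightarrow>
       (\<exists>!t. t \<in> Hom_AC (Sym n C\<^sub>1) D \<and>
             (\<forall>xs\<in>listset (replicate n (cone_of C\<^sub>1)). T xs = t (sym_of xs))))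
     \<and>
     (\<forall>(A :: 'a conic_space) (B :: 'a conic_space) (C :: 'd conic_space).
       A \<in> AC \<and> B \<in> AC \<and> C \<in> AC \<longrightarrow>
       iso_AC (Hom_cone (Tensor [A, B]) C) (Hom_cone A (Hom_cone B C)) (curry_AC A B C) \<and>
       (\<forall>(A' :: 'b::real_vector conic_space) (B' :: 'b conic_space) (C' :: 'e::real_vector conic_space).
          A' \<in> AC \<and> B' \<in> AC \<and> C' \<in> AC \<longrightarrow>
          (\<forall>\<alpha>\<in>Hom_AC A' A. \<forall>\<beta>\<in>Hom_AC B' B. \<forall>\<gamma>\<in>Hom_AC C C'. \<forall>f\<in>Hom_AC (Tensor [A, B]) C.
             curry_AC A' B' C' (\<gamma> \<circ> f \<circ> tensor_map A' B' A B \<alpha> \<beta>) =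
             (\<lambda>a. \<gamma> \<circ> curry_AC A B C f (\<alpha> a) \<circ> \<beta>))))"
proof (intro conjI allI impI)
  fix Cs :: "'a conic_space list" and D :: "'d conic_space" and T
  assume "length Cs = n \<and> set Cs \<subseteq> AC \<and> D \<in> AC \<and> multilinear_AC Cs D T"
  then show "\<exists>!t. t \<in> Hom_AC (Tensor Cs) D \<and>
      (\<forall>xs\<in>listset (map cone_of Cs). T xs = t (tensor_of xs))"
    using Tensor_universal by blast
next
  fix C\<^sub>1 :: "'a conic_space" and D :: "'d conic_space" and T
  assume "C\<^sub>1 \<in> AC \<and> D \<in> AC \<and> multilinear_AC (replicate n C\<^sub>1) D T \<and> symmetric_AC n C\<^sub>1 T"
  then show "\<exists>!t. t \<in> Hom_AC (Sym n C\<^sub>1) D \<and>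
      (\<forall>xs\<in>listset (replicate n (cone_of C\<^sub>1)). T xs = t (sym_of xs))"
    using Sym_universal by blast
next
  fix A B :: "'a conic_space" and C :: "'d conic_space"
  assume "A \<in> AC \<and> B \<in> AC \<and> C \<in> AC"
  then show "iso_AC (Hom_cone (Tensor [A, B]) C) (Hom_cone A (Hom_cone B C)) (curry_AC A B C)"
    using curry_iso by blast
next
  fix A B :: "'a conic_space" and C :: "'d conic_space"
    and A' B' :: "'b conic_space" and C' :: "'e conic_space"
  assume AC: "A \<in> AC \<and> B \<in> AC \<and> C \<in> AC" "A' \<in> AC \<and> B' \<in> AC \<and> C' \<in> AC"
  show "\<forall>\<alpha>\<in>Hom_AC A' A. \<forall>\<beta>\<in>Hom_AC B' B. \<forall>\<gamma>\<in>Hom_AC C C'. \<forall>f\<in>Hom_AC (Tensor [A, B]) C.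
      curry_AC A' B' C' (\<gamma> \<circ> f \<circ> tensor_map A' B' A B \<alpha> \<beta>) =
      (\<lambda>a. \<gamma> \<circ> curry_AC A B C f (\<alpha> a) \<circ> \<beta>)"
    using AC by (intro ballI curry_natural AC_D(1) Hom_AC_imp_linear) auto
qed

end
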